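(* (a) Let $\Lambda_t:L^{\infty}(\mathcal{F}_T)\times L^{\infty}(\mathcal{F}_T)\to L^{\infty}(\mathcal{F}_t)$, $t\in[0,T]$, be a dynamic capital allocation rule (CAR) satisfying no-undercut, monotonicity, weak-convexity, normalization, cash-subadditivity, and 1-time-consistency (resp. time-consistency). Then $\rho_t(X)\triangleq\Lambda_t(X,X)$, $X\in L^\infty(\mathcal F_T)$, $t\in[0,T]$, is a weakly time-consistent (resp. time-consistent) dynamic convex cash-subadditive risk measure. (b) Conversely, let $(\rho_t)_{t\in[0,T]}$ be a dynamic convex cash-subadditive risk measure that can be represented as $$\rho_t(X)=\operatorname*{ess\,sup}_{(D_t,\mathbb{Q}_t)\in\mathcal{D}\times\mathcal{Q}}\{D_t\,\mathbb{E}_{\mathbb{Q}_t}[-X|\mathcal{F}_t]-c_t(D_t\mathbb{Q}_t)\},\qquad X\in L^\infty(\mathcal F_T),\ t\in[0,T],$$ with the essential supremum attained for every $X$ and $t$. Then there exists at least one dynamic CAR $(\Lambda_t)_{t\in[0,T]}$ associated to $(\rho_t)_{t\in[0,T]}$ which satisfies no-undercut, monotonicity, weak-convexity, 1-cash-subadditivity and sub-allocation. In particular, the subdifferential CAR $$\Lambda^{sub}_t(X,Y)\triangleq\mathbb{E}_{\mathbb{Q}_t^Y}[-D^Y_tX|\mathcal{F}_t]-c_t(D^Y_t\mathbb{Q}^{Y}_t),\qquad X,Y\in L^\infty(\mathcal F_T),$$ where, for each $Y$ and $t$, $(D^Y_t,\mathbb{Q}^Y_t)\in\mathcal D\times\mathcal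 Q$ is a (fixed) pair attaining the essential supremum in the representation of $\rho_t(Y)$, is a CAR of this kind.
   Context: $T>0$, $(\Omega,\mathcal{F},(\mathcal{F}_t)_{t\in[0,T]},\mathbb{P})$ is a filtered probability space with $\mathcal F_0=\{\emptyset,\Omega\}$, $\mathcal F_T=\mathcal F$. (In)equalities between random variables are $\mathbb P$-a.s. $L^\infty_+(\mathcal F_t)$ denotes the a.s. nonnegative elements of $L^\infty(\mathcal F_t)$. Risk measures. A dynamic risk measure is a family $\rho_t:L^\infty(\mathcal F_T)\to L^\infty(\mathcal F_t)$, $t\in[0,T]$, with $\rho_T(X)=-X$ for all $X$. It is convex if it satisfies: monotonicity ($X\ge Y\Rightarrow\rho_t(X)\le\rho_t(Y)$); convexity ($\rho_t(\alpha X+(1-\alpha)Y)\le\alpha\rho_t(X)+(1-\alpha)\rho_t(Y)$ for $\alpha\in[0,1]$); normalization ($\rho_t(0)=0$). It is cash-subadditive if $\rho_t(X+m_t)\ge\rho_t(X)-m_t$ for all $m_t\in L^\infty_+(\mathcal F_t)$; time-consistent if $\rho_s(X)=\rho_s(-\rho_t(X))$ for all $s\le t$; weakly time-consistent if $\rho_s(X)\le\rho_s(-\rho_t(X))$ for all $s\le t$. CARs. A dynamic CAR associated to a dynamic risk measure $(\rho_t)$ is a family $\Lambda_t:L^\infty(\mathcal F_T)\times L^\infty(\mathcal F_T)\to L^\infty(\mathcal F_t)$ with $\Lambda_t(X,X)=\rho_t(X)$ for all $X$, $t$; a dynamic CAR is one associated to some dynamic risk measure. For $X,Y,Z\in L^\infty(\mathcal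 F_T)$ and $t\in[0,T]$ arbitrary: - monotonicity: $X\ge Y\Rightarrow\Lambda_t(X,Z)\le\Lambda_t(Y,Z)$; - no-undercut: $\Lambda_t(X,Y)\le\Lambda_t(X,X)$; - cash-subadditivity: $\Lambda_t(X+m_t,Y+m_t)\ge\Lambda_t(X,Y)-m_t$ for $m_t\in L^\infty_+(\mathcal F_t)$; - 1-cash-subadditivity: $\Lambda_t(X+m_t,Y)\ge\Lambda_t(X,Y)-m_t$ for $m_t\in L^\infty_+(\mathcal F_t)$; - normalization: $\Lambda_t(0,X)=0$; - sub-allocation: $\Lambda_t(X,X)\ge\sum_{i=1}^k\Lambda_t(X_i,X)$ whenever $\sum_{i=1}^kX_i=X$; - weak-convexity: $\Lambda_t(\sum_{i=1}^ka_iX_i,X)\le\sum_{i=1}^ka_i\Lambda_t(X_i,X)$ whenever $a_i\in[0,1]$, $\sum_ia_i=1$, $\sum_ia_iX_i=X$; - 1-time-consistency: $\Lambda_s(-\Lambda_t(X,Y),Y)=\Lambda_s(X,Y)$ for $s\le t$; - time-consistency: $\Lambda_s(-\Lambda_t(X,Y),-\Lambda_t(Y,Y))=\Lambda_s(X,Y)$ for $s\le t$. Dual objects. $\mathcal Q$ is, for each $t$, the set of probability measures $\mathbb Q_t\ll\mathbb P$ on $(\Omega,\mathcal F)$ with $\mathbb Q_t|_{\mathcal F_t}=\mathbb P|_{\mathcal F_t}$; $\mathcal D$ is the set of adapted processes $(D_t)_{t\in[0,T]}$ with $D_t\in[0,1]$ a.s. for all $t$. The generalized penalty $c_t(D_t\mathbb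 Q_t)$ is a nonnegative, $\mathcal F_t$-measurable (possibly $+\infty$-valued) random variable. *)

theory Defs
  imports "HOL-Probability.Probability"
begin

text \<open>
  Elements of \<open>L\<^sup>\<infinity>\<close> are represented by functions on the sample space. All (in)equalities between
  them are stated almost surely, and every operator on \<open>L\<^sup>\<infinity>\<close> is required to send almost surely
  equal arguments to almost surely equal values, i.e. to be well defined on equivalence classes.
\<close>

locale filtered_prob_space = prob_space M
  for M :: "'a measure" and F :: "real \<Rightarrow> 'a measure" and T :: real +
  assumes horizon_pos: "0 < T"
    and subalgebra_F: "t \<in> {0..T} \<Longrightarrow> subalgebra M (F t)"
    and F_mono: "s \<in> {0..T} \<Longrightarrow> t \<in> {0..T} \<Longrightarrow> s \<le> t \<Longrightarrow> sets (F s) \<subseteq> sets (F t)"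
    and F_0: "sets (F 0) = {{}, space M}"
    and F_T: "sets (F T) = sets M"

definition Linf :: "'a measure \<Rightarrow> 'a measure \<Rightarrow> ('a \<Rightarrow> real) set" where
  "Linf M G = {X \<in> borel_measurable G. \<exists>C. AE \<omega> in M. \<bar>X \<omega>\<bar> \<le> C}"

definition Linf_plus :: "'a measure \<Rightarrow> 'a measure \<Rightarrow> ('a \<Rightarrow> real) set" where
  "Linf_plus M G = {X \<in> Linf M G. AE \<omega> in M. 0 \<le> X \<omega>}"

subsection \<open>Dynamic risk measures\<close>

definition dynamic_risk_measure ::
  "'a measure \<Rightarrow> (real \<Rightarrow> 'a measure) \<Rightarrow> real \<Rightarrow> (real \<Rightarrow> ('a \<Rightarrow> real) \<Rightarrow> 'a \<Rightarrow> real) \<Rightarrow> bool" where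
  "dynamic_risk_measure M F T \<rho> \<longleftrightarrow>
     (\<forall>t\<in>{0..T}. \<forall>X\<in>Linf M (F T). \<rho> t X \<in> Linf M (F t)) \<and>
     (\<forall>t\<in>{0..T}. \<forall>X\<in>Linf M (F T). \<forall>Y\<in>Linf M (F T).
        (AE \<omega> in M. X \<omega> = Y \<omega>) \<longrightarrow> (AE \<omega> in M. \<rho> t X \<omega> = \<rho> t Y \<omega>)) \<and>
     (\<forall>X\<in>Linf M (F T). AE \<omega> in M. \<rho> T X \<omega> = - X \<omega>)"

definition rm_monotone ::
  "'a measure \<Rightarrow> (real \<Rightarrow> 'a measure) \<Rightarrow> real \<Rightarrow> (real \<Rightarrow> ('a \<Rightarrow> real) \<Rightarrow> 'a \<Rightarrow> real) \<Rightarrow> bool" where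
  "rm_monotone M F T \<rho> \<longleftrightarrow>
     (\<forall>t\<in>{0..T}. \<forall>X\<in>Linf M (F T). \<forall>Y\<in>Linf M (F T).
        (AE \<omega> in M. X \<omega> \<ge> Y \<omega>) \<longrightarrow> (AE \<omega> in M. \<rho> t X \<omega> \<le> \<rho> t Y \<omega>))"

definition rm_convexity ::
  "'a measure \<Rightarrow> (real \<Rightarrow> 'a measure) \<Rightarrow> real \<Rightarrow> (real \<Rightarrow> ('a \<Rightarrow> real) \<Rightarrow> 'a \<Rightarrow> real) \<Rightarrow> bool" where
  "rm_convexity M F T \<rho> \<longleftrightarrow>
     (\<forall>t\<in>{0..T}. \<forall>X\<in>Linf M (F T). \<forall>Y\<in>Linf M (F T). \<forall>\<alpha>\<in>{0..1}.
        AE \<omega> in M. \<rho> t (\<lambda>\<omega>. \<alpha> * X \<omega> + (1 - \<alpha>) * Y \<omega>) \<omega> \<le> \<alpha> * \<rho> t X \<omega> + (1 - \<alpha>) * \<rho> t Y \<omega>)"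

definition rm_normalized ::
  "'a measure \<Rightarrow> real \<Rightarrow> (real \<Rightarrow> ('a \<Rightarrow> real) \<Rightarrow> 'a \<Rightarrow> real) \<Rightarrow> bool" where
  "rm_normalized M T \<rho> \<longleftrightarrow> (\<forall>t\<in>{0..T}. AE \<omega> in M. \<rho> t (\<lambda>_. 0) \<omega> = 0)"

definition convex_risk_measure ::
  "'a measure \<Rightarrow> (real \<Rightarrow> 'a measure) \<Rightarrow> real \<Rightarrow> (real \<Rightarrow> ('a \<Rightarrow> real) \<Rightarrow> 'a \<Rightarrow> real) \<Rightarrow> bool" where
  "convex_risk_measure M F T \<rho> \<longleftrightarrow>
     dynamic_risk_measure M F T \<rho> \<and> rm_monotone M F T \<rho> \<and> rm_convexity M F T \<rho> \<and>
     rm_normalized M T \<rho>"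

definition rm_cash_subadditive ::
  "'a measure \<Rightarrow> (real \<Rightarrow> 'a measure) \<Rightarrow> real \<Rightarrow> (real \<Rightarrow> ('a \<Rightarrow> real) \<Rightarrow> 'a \<Rightarrow> real) \<Rightarrow> bool" where
  "rm_cash_subadditive M F T \<rho> \<longleftrightarrow>
     (\<forall>t\<in>{0..T}. \<forall>X\<in>Linf M (F T). \<forall>m\<in>Linf_plus M (F t).
        AE \<omega> in M. \<rho> t (\<lambda>\<omega>. X \<omega> + m \<omega>) \<omega> \<ge> \<rho> t X \<omega> - m \<omega>)"

definition rm_time_consistent ::
  "'a measure \<Rightarrow> (real \<Rightarrow> 'a measure) \<Rightarrow> real \<Rightarrow> (real \<Rightarrow> ('a \<Rightarrow> real) \<Rightarrow> 'a \<Rightarrow> real) \<Rightarrow> bool" where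
  "rm_time_consistent M F T \<rho> \<longleftrightarrow>
     (\<forall>s\<in>{0..T}. \<forall>t\<in>{0..T}. s \<le> t \<longrightarrow> (\<forall>X\<in>Linf M (F T).
        AE \<omega> in M. \<rho> s X \<omega> = \<rho> s (\<lambda>\<omega>. - \<rho> t X \<omega>) \<omega>))"

definition rm_weakly_time_consistent ::
  "'a measure \<Rightarrow> (real \<Rightarrow> 'a measure) \<Rightarrow> real \<Rightarrow> (real \<Rightarrow> ('a \<Rightarrow> real) \<Rightarrow> 'a \<Rightarrow> real) \<Rightarrow> bool" where
  "rm_weakly_time_consistent M F T \<rho> \<longleftrightarrow>
     (\<forall>s\<in>{0..T}. \<forall>t\<in>{0..T}. s \<le> t \<longrightarrow> (\<forall>X\<in>Linf M (F T).
        AE \<omega> in M. \<rho> s X \<omega> \<le> \<rho> s (\<lambda>\<omega>. - \<rho> t X \<omega>) \<omega>))"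

subsection \<open>Dynamic capital allocation rules\<close>

definition CAR_associated ::
  "'a measure \<Rightarrow> (real \<Rightarrow> 'a measure) \<Rightarrow> real \<Rightarrow> (real \<Rightarrow> ('a \<Rightarrow> real) \<Rightarrow> 'a \<Rightarrow> real) \<Rightarrow>
   (real \<Rightarrow> ('a \<Rightarrow> real) \<Rightarrow> ('a \<Rightarrow> real) \<Rightarrow> 'a \<Rightarrow> real) \<Rightarrow> bool" where
  "CAR_associated M F T \<rho> \<Lambda> \<longleftrightarrow>
     (\<forall>t\<in>{0..T}. \<forall>X\<in>Linf M (F T). \<forall>Y\<in>Linf M (F T). \<Lambda> t X Y \<in> Linf M (F t)) \<and>
     (\<forall>t\<in>{0..T}. \<forall>X\<in>Linf M (F T). \<forall>X'\<in>Linf M (F T). \<forall>Y\<in>Linf M (F T). \<forall>Y'\<in>Linf M (F T).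
        (AE \<omega> in M. X \<omega> = X' \<omega>) \<longrightarrow> (AE \<omega> in M. Y \<omega> = Y' \<omega>) \<longrightarrow>
        (AE \<omega> in M. \<Lambda> t X Y \<omega> = \<Lambda> t X' Y' \<omega>)) \<and>
     (\<forall>t\<in>{0..T}. \<forall>X\<in>Linf M (F T). AE \<omega> in M. \<Lambda> t X X \<omega> = \<rho> t X \<omega>)"

definition dynamic_CAR ::
  "'a measure \<Rightarrow> (real \<Rightarrow> 'a measure) \<Rightarrow> real \<Rightarrow>
   (real \<Rightarrow> ('a \<Rightarrow> real) \<Rightarrow> ('a \<Rightarrow> real) \<Rightarrow> 'a \<Rightarrow> real) \<Rightarrow> bool" where
  "dynamic_CAR M F T \<Lambda> \<longleftrightarrow> (\<exists>\<rho>. dynamic_risk_measure M F T \<rho> \<and> CAR_associated M F T \<rho> \<Lambda>)"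

definition car_monotone ::
  "'a measure \<Rightarrow> (real \<Rightarrow> 'a measure) \<Rightarrow> real \<Rightarrow>
   (real \<Rightarrow> ('a \<Rightarrow> real) \<Rightarrow> ('a \<Rightarrow> real) \<Rightarrow> 'a \<Rightarrow> real) \<Rightarrow> bool" where
  "car_monotone M F T \<Lambda> \<longleftrightarrow>
     (\<forall>t\<in>{0..T}. \<forall>X\<in>Linf M (F T). \<forall>Y\<in>Linf M (F T). \<forall>Z\<in>Linf M (F T).
        (AE \<omega> in M. X \<omega> \<ge> Y \<omega>) \<longrightarrow> (AE \<omega> in M. \<Lambda> t X Z \<omega> \<le> \<Lambda> t Y Z \<omega>))"

definition car_no_undercut ::
  "'a measure \<Rightarrow> (real \<Rightarrow> 'a measure) \<Rightarrow> real \<Rightarrow>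
   (real \<Rightarrow> ('a \<Rightarrow> real) \<Rightarrow> ('a \<Rightarrow> real) \<Rightarrow> 'a \<Rightarrow> real) \<Rightarrow> bool" where
  "car_no_undercut M F T \<Lambda> \<longleftrightarrow>
     (\<forall>t\<in>{0..T}. \<forall>X\<in>Linf M (F T). \<forall>Y\<in>Linf M (F T). AE \<omega> in M. \<Lambda> t X Y \<omega> \<le> \<Lambda> t X X \<omega>)"

definition car_cash_subadditive ::
  "'a measure \<Rightarrow> (real \<Rightarrow> 'a measure) \<Rightarrow> real \<Rightarrow>
   (real \<Rightarrow> ('a \<Rightarrow> real) \<Rightarrow> ('a \<Rightarrow> real) \<Rightarrow> 'a \<Rightarrow> real) \<Rightarrow> bool" where
  "car_cash_subadditive M F T \<Lambda> \<longleftrightarrow>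
     (\<forall>t\<in>{0..T}. \<forall>X\<in>Linf M (F T). \<forall>Y\<in>Linf M (F T). \<forall>m\<in>Linf_plus M (F t).
        AE \<omega> in M. \<Lambda> t (\<lambda>\<omega>. X \<omega> + m \<omega>) (\<lambda>\<omega>. Y \<omega> + m \<omega>) \<omega> \<ge> \<Lambda> t X Y \<omega> - m \<omega>)"

definition car_1_cash_subadditive ::
  "'a measure \<Rightarrow> (real \<Rightarrow> 'a measure) \<Rightarrow> real \<Rightarrow>
   (real \<Rightarrow> ('a \<Rightarrow> real) \<Rightarrow> ('a \<Rightarrow> real) \<Rightarrow> 'a \<Rightarrow> real) \<Rightarrow> bool" where
  "car_1_cash_subadditive M F T \<Lambda> \<longleftrightarrow>
     (\<forall>t\<in>{0..T}. \<forall>X\<in>Linf M (F T). \<forall>Y\<in>Linf M (F T). \<forall>m\<in>Linf_plus M (F t).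
        AE \<omega> in M. \<Lambda> t (\<lambda>\<omega>. X \<omega> + m \<omega>) Y \<omega> \<ge> \<Lambda> t X Y \<omega> - m \<omega>)"

definition car_normalized ::
  "'a measure \<Rightarrow> (real \<Rightarrow> 'a measure) \<Rightarrow> real \<Rightarrow>
   (real \<Rightarrow> ('a \<Rightarrow> real) \<Rightarrow> ('a \<Rightarrow> real) \<Rightarrow> 'a \<Rightarrow> real) \<Rightarrow> bool" where
  "car_normalized M F T \<Lambda> \<longleftrightarrow>
     (\<forall>t\<in>{0..T}. \<forall>X\<in>Linf M (F T). AE \<omega> in M. \<Lambda> t (\<lambda>_. 0) X \<omega> = 0)"

definition car_sub_allocation ::
  "'a measure \<Rightarrow> (real \<Rightarrow> 'a measure) \<Rightarrow> real \<Rightarrow>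
   (real \<Rightarrow> ('a \<Rightarrow> real) \<Rightarrow> ('a \<Rightarrow> real) \<Rightarrow> 'a \<Rightarrow> real) \<Rightarrow> bool" where
  "car_sub_allocation M F T \<Lambda> \<longleftrightarrow>
     (\<forall>t\<in>{0..T}. \<forall>X\<in>Linf M (F T). \<forall>k\<ge>1. \<forall>Xs :: nat \<Rightarrow> 'a \<Rightarrow> real.
        (\<forall>i\<in>{1..k}. Xs i \<in> Linf M (F T)) \<longrightarrow>
        (AE \<omega> in M. (\<Sum>i=1..k. Xs i \<omega>) = X \<omega>) \<longrightarrow>
        (AE \<omega> in M. \<Lambda> t X X \<omega> \<ge> (\<Sum>i=1..k. \<Lambda> t (Xs i) X \<omega>)))"

definition car_weak_convex ::
  "'a measure \<Rightarrow> (real \<Rightarrow> 'a measure) \<Rightarrow> real \<Rightarrow>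
   (real \<Rightarrow> ('a \<Rightarrow> real) \<Rightarrow> ('a \<Rightarrow> real) \<Rightarrow> 'a \<Rightarrow> real) \<Rightarrow> bool" where
  "car_weak_convex M F T \<Lambda> \<longleftrightarrow>
     (\<forall>t\<in>{0..T}. \<forall>X\<in>Linf M (F T). \<forall>k. \<forall>Xs :: nat \<Rightarrow> 'a \<Rightarrow> real. \<forall>a :: nat \<Rightarrow> real.
        (\<forall>i\<in>{1..k}. Xs i \<in> Linf M (F T)) \<longrightarrow>
        (\<forall>i\<in>{1..k}. a i \<in> {0..1}) \<longrightarrow> (\<Sum>i=1..k. a i) = 1 \<longrightarrow>
        (AE \<omega> in M. (\<Sum>i=1..k. a i * Xs i \<omega>) = X \<omega>) \<longrightarrow>
        (AE \<omega> in M. \<Lambda> t (\<lambda>\<omega>. \<Sum>i=1..k. a i * Xs i \<omega>) X \<omega> \<le> (\<Sum>i=1..k. a i * \<Lambda> t (Xs i) X \<omega>)))"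

definition car_1_time_consistent ::
  "'a measure \<Rightarrow> (real \<Rightarrow> 'a measure) \<Rightarrow> real \<Rightarrow>
   (real \<Rightarrow> ('a \<Rightarrow> real) \<Rightarrow> ('a \<Rightarrow> real) \<Rightarrow> 'a \<Rightarrow> real) \<Rightarrow> bool" where
  "car_1_time_consistent M F T \<Lambda> \<longleftrightarrow>
     (\<forall>s\<in>{0..T}. \<forall>t\<in>{0..T}. s \<le> t \<longrightarrow> (\<forall>X\<in>Linf M (F T). \<forall>Y\<in>Linf M (F T).
        AE \<omega> in M. \<Lambda> s (\<lambda>\<omega>. - \<Lambda> t X Y \<omega>) Y \<omega> = \<Lambda> s X Y \<omega>))"

definition car_time_consistent ::
  "'a measure \<Rightarrow> (real \<Rightarrow> 'a measure) \<Rightarrow> real \<Rightarrow>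
   (real \<Rightarrow> ('a \<Rightarrow> real) \<Rightarrow> ('a \<Rightarrow> real) \<Rightarrow> 'a \<Rightarrow> real) \<Rightarrow> bool" where
  "car_time_consistent M F T \<Lambda> \<longleftrightarrow>
     (\<forall>s\<in>{0..T}. \<forall>t\<in>{0..T}. s \<le> t \<longrightarrow> (\<forall>X\<in>Linf M (F T). \<forall>Y\<in>Linf M (F T).
        AE \<omega> in M. \<Lambda> s (\<lambda>\<omega>. - \<Lambda> t X Y \<omega>) (\<lambda>\<omega>. - \<Lambda> t Y Y \<omega>) \<omega> = \<Lambda> s X Y \<omega>))"

subsection \<open>Dual representation\<close>

definition dual_measures ::
  "'a measure \<Rightarrow> (real \<Rightarrow> 'a measure) \<Rightarrow> real \<Rightarrow> 'a measure set" where
  "dual_measures M F t =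
     {Q. prob_space Q \<and> sets Q = sets M \<and> absolutely_continuous M Q \<and>
         (\<forall>A\<in>sets (F t). emeasure Q A = emeasure M A)}"

definition discount_processes ::
  "'a measure \<Rightarrow> (real \<Rightarrow> 'a measure) \<Rightarrow> real \<Rightarrow> (real \<Rightarrow> 'a \<Rightarrow> real) set" where
  "discount_processes M F T =
     {D. \<forall>t\<in>{0..T}. D t \<in> borel_measurable (F t) \<and> (AE \<omega> in M. 0 \<le> D t \<omega> \<and> D t \<omega> \<le> 1)}"

text \<open>The (sub-probability) measure \<open>D\<^sub>t Q\<^sub>t\<close> that is the argument of the penalty.\<close>

definition discounted_measure :: "('a \<Rightarrow> real) \<Rightarrow> 'a measure \<Rightarrow> 'a measure" where
  "discounted_measure d Q = density Q (\<lambda>\<omega>. ennreal (d \<omega>))"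

definition generalized_penalty ::
  "'a measure \<Rightarrow> (real \<Rightarrow> 'a measure) \<Rightarrow> real \<Rightarrow> (real \<Rightarrow> 'a measure \<Rightarrow> 'a \<Rightarrow> ereal) \<Rightarrow> bool" where
  "generalized_penalty M F T c \<longleftrightarrow>
     (\<forall>t\<in>{0..T}. \<forall>D\<in>discount_processes M F T. \<forall>Q\<in>dual_measures M F t.
        c t (discounted_measure (D t) Q) \<in> borel_measurable (F t) \<and>
        (AE \<omega> in M. 0 \<le> c t (discounted_measure (D t) Q) \<omega>))"

definition penalized_expectation ::
  "(real \<Rightarrow> 'a measure) \<Rightarrow> (real \<Rightarrow> 'a measure \<Rightarrow> 'a \<Rightarrow> ereal) \<Rightarrow> real \<Rightarrow>
   ('a \<Rightarrow> real) \<Rightarrow> 'a measure \<Rightarrow> ('a \<Rightarrow> real) \<Rightarrow> 'a \<Rightarrow> ereal" where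
  "penalized_expectation F c t d Q X \<omega> =
     ereal (d \<omega> * real_cond_exp Q (F t) (\<lambda>\<omega>. - X \<omega>) \<omega>) - c t (discounted_measure d Q) \<omega>"

text \<open>
  The essential supremum of a (possibly uncountable) family of random variables; the constant
  \<^const>\<open>esssup\<close> of the library is the essential supremum of a single function.
\<close>

definition is_ess_sup :: "'a measure \<Rightarrow> ('a \<Rightarrow> ereal) set \<Rightarrow> ('a \<Rightarrow> ereal) \<Rightarrow> bool" where
  "is_ess_sup M \<Phi> Z \<longleftrightarrow>
     Z \<in> borel_measurable M \<and>
     (\<forall>\<phi>\<in>\<Phi>. AE \<omega> in M. \<phi> \<omega> \<le> Z \<omega>) \<and>
     (\<forall>W\<in>borel_measurable M. (\<forall>\<phi>\<in>\<Phi>. AE \<omega> in M. \<phi> \<omega> \<le> W \<omega>) \<longrightarrow> (AE \<omega> in M. Z \<omega> \<le> W \<omega>))"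

definition dual_representation ::
  "'a measure \<Rightarrow> (real \<Rightarrow> 'a measure) \<Rightarrow> real \<Rightarrow> (real \<Rightarrow> 'a measure \<Rightarrow> 'a \<Rightarrow> ereal) \<Rightarrow>
   (real \<Rightarrow> ('a \<Rightarrow> real) \<Rightarrow> 'a \<Rightarrow> real) \<Rightarrow> bool" where
  "dual_representation M F T c \<rho> \<longleftrightarrow>
     (\<forall>t\<in>{0..T}. \<forall>X\<in>Linf M (F T).
        is_ess_sup M
          {penalized_expectation F c t (D t) Q X | D Q.
             D \<in> discount_processes M F T \<and> Q \<in> dual_measures M F t}
          (\<lambda>\<omega>. ereal (\<rho> t X \<omega>)))"

definition attains ::
  "'a measure \<Rightarrow> (real \<Rightarrow> 'a measure) \<Rightarrow> (real \<Rightarrow> 'a measure \<Rightarrow> 'a \<Rightarrow> ereal) \<Rightarrow>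
   (real \<Rightarrow> ('a \<Rightarrow> real) \<Rightarrow> 'a \<Rightarrow> real) \<Rightarrow> real \<Rightarrow> ('a \<Rightarrow> real) \<Rightarrow> 'a measure \<Rightarrow> ('a \<Rightarrow> real) \<Rightarrow> bool"
  where
  "attains M F c \<rho> t d Q X \<longleftrightarrow>
     (AE \<omega> in M. ereal (\<rho> t X \<omega>) = penalized_expectation F c t d Q X \<omega>)"

definition dual_attainment ::
  "'a measure \<Rightarrow> (real \<Rightarrow> 'a measure) \<Rightarrow> real \<Rightarrow> (real \<Rightarrow> 'a measure \<Rightarrow> 'a \<Rightarrow> ereal) \<Rightarrow>
   (real \<Rightarrow> ('a \<Rightarrow> real) \<Rightarrow> 'a \<Rightarrow> real) \<Rightarrow> bool" where
  "dual_attainment M F T c \<rho> \<longleftrightarrow>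
     (\<forall>t\<in>{0..T}. \<forall>X\<in>Linf M (F T).
        \<exists>D\<in>discount_processes M F T. \<exists>Q\<in>dual_measures M F t. attains M F c \<rho> t (D t) Q X)"

text \<open>
  A choice of one maximizing pair \<open>(D Y t, Q Y t)\<close> for every \<open>t\<close> and every \<open>Y \<in> L\<^sup>\<infinity>\<close>. The second
  conjunct expresses that the pair is chosen for the equivalence class of \<open>Y\<close>.
\<close>

definition optimal_selection ::
  "'a measure \<Rightarrow> (real \<Rightarrow> 'a measure) \<Rightarrow> real \<Rightarrow> (real \<Rightarrow> 'a measure \<Rightarrow> 'a \<Rightarrow> ereal) \<Rightarrow>
   (real \<Rightarrow> ('a \<Rightarrow> real) \<Rightarrow> 'a \<Rightarrow> real) \<Rightarrow>
   (('a \<Rightarrow> real) \<Rightarrow> real \<Rightarrow> 'a \<Rightarrow> real) \<Rightarrow> (('a \<Rightarrow> real) \<Rightarrow> real \<Rightarrow> 'a measure) \<Rightarrow> bool" where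
  "optimal_selection M F T c \<rho> D Q \<longleftrightarrow>
     (\<forall>Y\<in>Linf M (F T). D Y \<in> discount_processes M F T \<and>
        (\<forall>t\<in>{0..T}. Q Y t \<in> dual_measures M F t \<and> attains M F c \<rho> t (D Y t) (Q Y t) Y)) \<and>
     (\<forall>Y\<in>Linf M (F T). \<forall>Y'\<in>Linf M (F T). (AE \<omega> in M. Y \<omega> = Y' \<omega>) \<longrightarrow>
        (\<forall>t\<in>{0..T}. (AE \<omega> in M. D Y t \<omega> = D Y' t \<omega>) \<and> Q Y t = Q Y' t))"

text \<open>
  At a maximizing pair the penalty is almost surely finite, because \<open>\<rho> t Y\<close> is real-valued, so
  \<^const>\<open>real_of_ereal\<close> changes it on a null set only.
\<close>

definition subdifferential_CAR ::
  "(real \<Rightarrow> 'a measure) \<Rightarrow> (real \<Rightarrow> 'a measure \<Rightarrow> 'a \<Rightarrow> ereal) \<Rightarrow>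
   (('a \<Rightarrow> real) \<Rightarrow> real \<Rightarrow> 'a \<Rightarrow> real) \<Rightarrow> (('a \<Rightarrow> real) \<Rightarrow> real \<Rightarrow> 'a measure) \<Rightarrow>
   real \<Rightarrow> ('a \<Rightarrow> real) \<Rightarrow> ('a \<Rightarrow> real) \<Rightarrow> 'a \<Rightarrow> real" where
  "subdifferential_CAR F c D Q t X Y \<omega> =
     real_cond_exp (Q Y t) (F t) (\<lambda>\<omega>. - (D Y t \<omega> * X \<omega>)) \<omega>
     - real_of_ereal (c t (discounted_measure (D Y t) (Q Y t)) \<omega>)"

end

theory Submission
  imports Defs
begin

text \<open>
  Part (a) puts the second argument of \<open>\<Lambda>\<close> equal to the first one, no-undercut being what removes
  the dependence on the reference position. For part (b), \<open>D\<^sub>t\<close> is \<open>\<F>\<^sub>t\<close>-measurable, so it can be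
  taken out of the conditional expectation, and the subdifferential allocation of \<open>X\<close> with
  respect to \<open>Y\<close> is the member of the family defining \<open>\<rho>\<^sub>t(X)\<close> that is indexed by the maximizer
  for \<open>Y\<close>. Hence it lies below \<open>\<rho>\<^sub>t(X)\<close>, with equality for \<open>X = Y\<close>, and it is affine in \<open>X\<close> with a
  nonnegative penalty; the remaining axioms follow. Inequalities between \<open>\<F>\<^sub>t\<close>-measurable functions
  that hold \<open>Q\<close>-almost surely transfer to the reference measure because the two measures agree
  on \<open>\<F>\<^sub>t\<close>.
\<close>

section \<open>Almost surely bounded random variables form an algebra\<close>

lemma Linf_measurable: "X \<in> Linf M G \<Longrightarrow> X \<in> borel_measurable G"
  by (simp add: Linf_def)

text \<open>The bound is made nonnegative because bounding a product by a product of bounds needs a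
  sign.\<close>

lemma LinfE:
  assumes "X \<in> Linf M G"
  obtains C where "0 \<le> C" "AE \<omega> in M. \<bar>X \<omega>\<bar> \<le> C"
proof -
  obtain C where "AE \<omega> in M. \<bar>X \<omega>\<bar> \<le> C"
    using assms by (auto simp: Linf_def)
  then have "AE \<omega> in M. \<bar>X \<omega>\<bar> \<le> max C 0"
    by eventually_elim auto
  then show ?thesis
    by (intro that[of "max C 0"]) auto
qed

lemma LinfI: "X \<in> borel_measurable G \<Longrightarrow> AE \<omega> in M. \<bar>X \<omega>\<bar> \<le> C \<Longrightarrow> X \<in> Linf M G"
  by (auto simp: Linf_def)

lemma Linf_const: "(\<lambda>_. c) \<in> Linf M G"
  by (rule LinfI[where C = "\<bar>c\<bar>"]) auto

lemma Linf_uminus: "X \<in> Linf M G \<Longrightarrow> (\<lambda>\<omega>. - X \<omega>) \<in> Linf M G"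
  by (auto simp: Linf_def)

lemma Linf_add:
  assumes "X \<in> Linf M G" "Y \<in> Linf M G"
  shows "(\<lambda>\<omega>. X \<omega> + Y \<omega>) \<in> Linf M G"
proof -
  obtain C D where "AE \<omega> in M. \<bar>X \<omega>\<bar> \<le> C" "AE \<omega> in M. \<bar>Y \<omega>\<bar> \<le> D"
    using assms by (auto elim!: LinfE)
  then have "AE \<omega> in M. \<bar>X \<omega> + Y \<omega>\<bar> \<le> C + D"
    by eventually_elim auto
  with assms show ?thesis
    by (intro LinfI[where C = "C + D"] borel_measurable_add) (auto dest: Linf_measurable)
qed

lemma Linf_mult:
  assumes "X \<in> Linf M G" "Y \<in> Linf M G"
  shows "(\<lambda>\<omega>. X \<omega> * Y \<omega>) \<in> Linf M G"
proof -
  obtain C where C: "0 \<le> C" "AE \<omega> in M. \<bar>X \<omega>\<bar> \<le> C"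
    using assms(1) by (rule LinfE)
  obtain D where D: "AE \<omega> in M. \<bar>Y \<omega>\<bar> \<le> D"
    using assms(2) by (rule LinfE)
  from C(2) D have "AE \<omega> in M. \<bar>X \<omega> * Y \<omega>\<bar> \<le> C * D"
    by eventually_elim (simp add: abs_mult mult_mono C(1))
  with assms show ?thesis
    by (intro LinfI[where C = "C * D"] borel_measurable_times) (auto dest: Linf_measurable)
qed

lemma Linf_sum:
  assumes "finite I" "\<And>i. i \<in> I \<Longrightarrow> X i \<in> Linf M G"
  shows "(\<lambda>\<omega>. \<Sum>i\<in>I. X i \<omega>) \<in> Linf M G"
  using assms by (induction I rule: finite_induct) (auto intro: Linf_const Linf_add)

section \<open>Passage along the filtration, and the diagonal of a CAR (part (a))\<close>

context filtered_prob_space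
begin

lemma borel_measurable_F_mono:
  assumes "s \<in> {0..T}" "t \<in> {0..T}" "s \<le> t" "f \<in> borel_measurable (F s)"
  shows "f \<in> borel_measurable (F t)"
proof (rule measurable_from_subalg[OF _ assms(4)])
  show "subalgebra (F t) (F s)"
    using subalgebra_F[OF assms(1)] subalgebra_F[OF assms(2)] F_mono[OF assms(1-3)]
    by (auto simp: subalgebra_def)
qed

lemma Linf_F_mono:
  assumes "s \<in> {0..T}" "t \<in> {0..T}" "s \<le> t" "X \<in> Linf M (F s)"
  shows "X \<in> Linf M (F t)"
  using assms borel_measurable_F_mono unfolding Linf_def by blast

text \<open>Operators act on terminal positions, so a value known at time \<open>t\<close> has to be
  read as an element of \<open>Linf M (F T)\<close> before it can serve as an argument
  again.\<close>

lemma Linf_F_T: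
  assumes "t \<in> {0..T}" "X \<in> Linf M (F t)"
  shows "X \<in> Linf M (F T)"
  using Linf_F_mono[of t T] assms horizon_pos by auto

text \<open>Monotonicity and convexity of the CAR compare allocations with one common reference.
  No-undercut then replaces that reference by the position itself: \<open>\<Lambda> t Y X\<close> is
  raised to \<open>\<Lambda> t Y Y\<close>, and the allocations with respect to the mixture
  \<open>Z\<close> are raised to the diagonal values at \<open>X\<close> and
  \<open>Y\<close>.\<close>

lemma convex_risk_measure_diagonal:
  assumes car: "dynamic_CAR M F T \<Lambda>" and nu: "car_no_undercut M F T \<Lambda>"
    and mono: "car_monotone M F T \<Lambda>" and wc: "car_weak_convex M F T \<Lambda>"
    and norm: "car_normalized M F T \<Lambda>"
  shows "convex_risk_measure M F T (\<lambda>t X. \<Lambda> t X X)"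
  unfolding convex_risk_measure_def
proof (intro conjI)
  obtain \<rho> where \<rho>: "dynamic_risk_measure M F T \<rho>" and as: "CAR_associated M F T \<rho> \<Lambda>"
    using car by (auto simp: dynamic_CAR_def)
  have T: "T \<in> {0..T}"
    using horizon_pos by auto
  have "AE \<omega> in M. \<Lambda> T X X \<omega> = - X \<omega>" if X: "X \<in> Linf M (F T)" for X
  proof -
    have "AE \<omega> in M. \<Lambda> T X X \<omega> = \<rho> T X \<omega>"
      using as T X by (auto simp: CAR_associated_def)
    moreover have "AE \<omega> in M. \<rho> T X \<omega> = - X \<omega>"
      using \<rho> X by (auto simp: dynamic_risk_measure_def)
    ultimately show ?thesis
      by eventually_elim simp
  qed
  then show "dynamic_risk_measure M F T (\<lambda>t X. \<Lambda> t X X)"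
    using as unfolding dynamic_risk_measure_def CAR_associated_def by blast
  show "rm_monotone M F T (\<lambda>t X. \<Lambda> t X X)"
    unfolding rm_monotone_def
  proof (intro ballI impI)
    fix t X Y
    assume *: "t \<in> {0..T}" "X \<in> Linf M (F T)" "Y \<in> Linf M (F T)" "AE \<omega> in M. X \<omega> \<ge> Y \<omega>"
    have "AE \<omega> in M. \<Lambda> t X X \<omega> \<le> \<Lambda> t Y X \<omega>"
      using mono * unfolding car_monotone_def by blast
    moreover have "AE \<omega> in M. \<Lambda> t Y X \<omega> \<le> \<Lambda> t Y Y \<omega>"
      using nu * unfolding car_no_undercut_def by blast
    ultimately show "AE \<omega> in M. \<Lambda> t X X \<omega> \<le> \<Lambda> t Y Y \<omega>"
      by eventually_elim simp
  qed
  show "rm_convexity M F T (\<lambda>t X. \<Lambda> t X X)"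
    unfolding rm_convexity_def
  proof (intro ballI)
    fix t X Y and \<alpha> :: real
    assume *: "t \<in> {0..T}" "X \<in> Linf M (F T)" "Y \<in> Linf M (F T)" and \<alpha>: "\<alpha> \<in> {0..1}"
    define Z where "Z = (\<lambda>\<omega>. \<alpha> * X \<omega> + (1 - \<alpha>) * Y \<omega>)"
    have Z: "Z \<in> Linf M (F T)"
      unfolding Z_def by (intro Linf_add Linf_mult Linf_const *)
    \<comment> \<open>The lower end is written \<open>Suc 0\<close> since this is the form into
      which the simplifier brings \<open>{1..2}\<close>.\<close>
    have two: "{Suc 0..2} = {1, 2}"
      by auto
    \<comment> \<open>The two-term mixture is coded as a family over the indices 1 and 2, to match
      the k-term form of weak convexity.\<close>
    define Xs where "Xs = (\<lambda>i::nat. if i = 1 then X else Y)"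
    define a where "a = (\<lambda>i::nat. if i = 1 then \<alpha> else 1 - \<alpha>)"
    have "AE \<omega> in M. \<Lambda> t (\<lambda>\<omega>. \<Sum>i=1..2. a i * Xs i \<omega>) Z \<omega> \<le> (\<Sum>i=1..2. a i * \<Lambda> t (Xs i) Z \<omega>)"
      using * \<alpha> Z
      by (intro wc[unfolded car_weak_convex_def, rule_format])
        (auto simp: two a_def Xs_def Z_def)
    then have "AE \<omega> in M. \<Lambda> t Z Z \<omega> \<le> \<alpha> * \<Lambda> t X Z \<omega> + (1 - \<alpha>) * \<Lambda> t Y Z \<omega>"
      by (simp add: two a_def Xs_def Z_def)
    moreover have "AE \<omega> in M. \<Lambda> t X Z \<omega> \<le> \<Lambda> t X X \<omega>" "AE \<omega> in M. \<Lambda> t Y Z \<omega> \<le> \<Lambda> t Y Y \<omega>"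
      using nu * Z unfolding car_no_undercut_def by blast+
    ultimately have "AE \<omega> in M. \<Lambda> t Z Z \<omega> \<le> \<alpha> * \<Lambda> t X X \<omega> + (1 - \<alpha>) * \<Lambda> t Y Y \<omega>"
    proof eventually_elim
      case (elim \<omega>)
      have "\<alpha> * \<Lambda> t X Z \<omega> \<le> \<alpha> * \<Lambda> t X X \<omega>" "(1 - \<alpha>) * \<Lambda> t Y Z \<omega> \<le> (1 - \<alpha>) * \<Lambda> t Y Y \<omega>"
        using elim \<alpha> by (auto intro: mult_left_mono)
      with elim(1) show ?case
        by linarith
    qed
    then show "AE \<omega> in M. \<Lambda> t (\<lambda>\<omega>. \<alpha> * X \<omega> + (1 - \<alpha>) * Y \<omega>) (\<lambda>\<omega>. \<alpha> * X \<omega> + (1 - \<alpha>) * Y \<omega>) \<omega>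
        \<le> \<alpha> * \<Lambda> t X X \<omega> + (1 - \<alpha>) * \<Lambda> t Y Y \<omega>"
      by (simp add: Z_def)
  qed
  show "rm_normalized M T (\<lambda>t X. \<Lambda> t X X)"
    using norm Linf_const[of 0 M "F T"] unfolding rm_normalized_def car_normalized_def by blast
qed

lemma cash_subadditive_diagonal:
  "car_cash_subadditive M F T \<Lambda> \<Longrightarrow> rm_cash_subadditive M F T (\<lambda>t X. \<Lambda> t X X)"
  by (simp add: car_cash_subadditive_def rm_cash_subadditive_def)

text \<open>1-time-consistency updates the first argument and keeps the reference \<open>X\<close>.
  Returning to the diagonal means changing the reference to the updated position, and no-undercut
  does this with an inequality only; hence the weak form.\<close>

lemma weakly_time_consistent_diagonal:
  assumes car: "dynamic_CAR M F T \<Lambda>" and nu: "car_no_undercut M F T \<Lambda>"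
    and tc: "car_1_time_consistent M F T \<Lambda>"
  shows "rm_weakly_time_consistent M F T (\<lambda>t X. \<Lambda> t X X)"
  unfolding rm_weakly_time_consistent_def
proof (intro ballI impI)
  fix s t X
  assume *: "s \<in> {0..T}" "t \<in> {0..T}" "s \<le> t" "X \<in> Linf M (F T)"
  have Y: "(\<lambda>\<omega>. - \<Lambda> t X X \<omega>) \<in> Linf M (F T)"
    using car * by (intro Linf_uminus Linf_F_T[of t]) (auto simp: dynamic_CAR_def CAR_associated_def)
  have "AE \<omega> in M. \<Lambda> s (\<lambda>\<omega>. - \<Lambda> t X X \<omega>) X \<omega> = \<Lambda> s X X \<omega>"
    using tc * unfolding car_1_time_consistent_def by blast
  moreover have "AE \<omega> in M. \<Lambda> s (\<lambda>\<omega>. - \<Lambda> t X X \<omega>) X \<omega>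
      \<le> \<Lambda> s (\<lambda>\<omega>. - \<Lambda> t X X \<omega>) (\<lambda>\<omega>. - \<Lambda> t X X \<omega>) \<omega>"
    using nu * Y unfolding car_no_undercut_def by blast
  ultimately show "AE \<omega> in M. \<Lambda> s X X \<omega> \<le> \<Lambda> s (\<lambda>\<omega>. - \<Lambda> t X X \<omega>) (\<lambda>\<omega>. - \<Lambda> t X X \<omega>) \<omega>"
    by eventually_elim simp
qed

text \<open>Here both arguments are updated together, so a diagonal pair stays diagonal and equality
  survives.\<close>

lemma time_consistent_diagonal:
  assumes tc: "car_time_consistent M F T \<Lambda>"
  shows "rm_time_consistent M F T (\<lambda>t X. \<Lambda> t X X)"
  unfolding rm_time_consistent_def
proof (intro ballI impI)
  fix s t X
  assume *: "s \<in> {0..T}" "t \<in> {0..T}" "s \<le> t" "X \<in> Linf M (F T)"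
  have "AE \<omega> in M. \<Lambda> s (\<lambda>\<omega>. - \<Lambda> t X X \<omega>) (\<lambda>\<omega>. - \<Lambda> t X X \<omega>) \<omega> = \<Lambda> s X X \<omega>"
    using tc * unfolding car_time_consistent_def by blast
  then show "AE \<omega> in M. \<Lambda> s X X \<omega> = \<Lambda> s (\<lambda>\<omega>. - \<Lambda> t X X \<omega>) (\<lambda>\<omega>. - \<Lambda> t X X \<omega>) \<omega>"
    by eventually_elim simp
qed

end

section \<open>Conditional expectation under a dual measure, stated almost surely under
  \<open>M\<close>\<close>

locale dual_measure = filtered_prob_space M F T
  for M :: "'a measure" and F :: "real \<Rightarrow> 'a measure" and T :: real +
  fixes t :: real and Q :: "'a measure"
  assumes time: "t \<in> {0..T}" and dual: "Q \<in> dual_measures M F t"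
begin

sublocale Q: prob_space Q
  using dual by (simp add: dual_measures_def)

lemma sets_Q: "sets Q = sets M"
  using dual by (simp add: dual_measures_def)

sublocale Q: finite_measure_subalgebra Q "F t"
proof
  show "subalgebra Q (F t)"
    using subalgebra_F[OF time] sets_Q sets_eq_imp_space_eq[OF sets_Q] by (simp add: subalgebra_def)
qed

lemma AE_Q: "AE \<omega> in M. P \<omega> \<Longrightarrow> AE \<omega> in Q. P \<omega>"
  using dual absolutely_continuous_AE[OF sets_Q] by (auto simp: dual_measures_def)

text \<open>Absolute continuity carries null sets from \<open>M\<close> to \<open>Q\<close> only.
  The converse works here because the exceptional set of two \<open>F t\<close>-measurable functions
  is an event of \<open>F t\<close>, where both measures give the same mass.\<close>

lemma AE_le_transfer:
  fixes f g :: "'a \<Rightarrow> real"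
  assumes "AE \<omega> in Q. f \<omega> \<le> g \<omega>" and [measurable]: "f \<in> borel_measurable (F t)" "g \<in> borel_measurable (F t)"
  shows "AE \<omega> in M. f \<omega> \<le> g \<omega>"
proof -
  define N where "N = {\<omega> \<in> space (F t). \<not> f \<omega> \<le> g \<omega>}"
  have N: "N \<in> sets (F t)"
    unfolding N_def by measurable
  have sp: "space (F t) = space M" "space Q = space M" and sub: "sets (F t) \<subseteq> sets M"
    using subalgebra_F[OF time] sets_eq_imp_space_eq[OF sets_Q] by (auto simp: subalgebra_def)
  have "emeasure M N = emeasure Q N"
    using dual N by (simp add: dual_measures_def)
  also have "\<dots> = 0"
    using assms(1) N sub sets_Q sp by (intro AE_iff_measurable[THEN iffD1]) (auto simp: N_def)
  finally show ?thesis
    using N sub sp by (intro AE_iff_measurable[where N = N, THEN iffD2]) (auto simp: N_def)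
qed

lemma AE_eq_transfer:
  fixes f g :: "'a \<Rightarrow> real"
  assumes "AE \<omega> in Q. f \<omega> = g \<omega>" "f \<in> borel_measurable (F t)" "g \<in> borel_measurable (F t)"
  shows "AE \<omega> in M. f \<omega> = g \<omega>"
proof -
  have "AE \<omega> in Q. f \<omega> \<le> g \<omega>" "AE \<omega> in Q. g \<omega> \<le> f \<omega>"
    using assms(1) by auto
  then have "AE \<omega> in M. f \<omega> \<le> g \<omega>" "AE \<omega> in M. g \<omega> \<le> f \<omega>"
    using assms by (auto intro: AE_le_transfer)
  then show ?thesis
    by eventually_elim simp
qed

lemma Linf_borel_Q: "X \<in> Linf M (F T) \<Longrightarrow> X \<in> borel_measurable Q"
  using measurable_cong_sets[of Q "F T" borel borel] sets_Q F_T Linf_measurable[of X M "F T"] by simp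

lemma Linf_integrable:
  assumes "X \<in> Linf M (F T)"
  shows "integrable Q X"
proof -
  obtain C where "AE \<omega> in M. \<bar>X \<omega>\<bar> \<le> C"
    using assms by (rule LinfE)
  then show ?thesis
    using AE_Q assms by (intro Q.integrable_const_bound[where B = C]) (auto intro: Linf_borel_Q)
qed

lemma cond_exp_mono:
  assumes "X \<in> Linf M (F T)" "Y \<in> Linf M (F T)" "AE \<omega> in M. X \<omega> \<le> Y \<omega>"
  shows "AE \<omega> in M. real_cond_exp Q (F t) X \<omega> \<le> real_cond_exp Q (F t) Y \<omega>"
  using assms by (intro AE_le_transfer Q.real_cond_exp_mono) (auto intro: Linf_integrable AE_Q)

lemma cond_exp_cong:
  assumes "X \<in> Linf M (F T)" "Y \<in> Linf M (F T)" "AE \<omega> in M. X \<omega> = Y \<omega>"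
  shows "AE \<omega> in M. real_cond_exp Q (F t) X \<omega> = real_cond_exp Q (F t) Y \<omega>"
  using assms by (intro AE_eq_transfer Q.real_cond_exp_cong) (auto intro: Linf_borel_Q AE_Q)

text \<open>Constant bounds pass to the conditional expectation under \<open>Q\<close>; as constants
  are \<open>F t\<close>-measurable, these bounds can be transferred back to
  \<open>M\<close>.\<close>

lemma cond_exp_Linf:
  assumes "X \<in> Linf M (F T)"
  shows "real_cond_exp Q (F t) X \<in> Linf M (F t)"
proof -
  obtain C where C: "AE \<omega> in M. \<bar>X \<omega>\<bar> \<le> C"
    using assms by (rule LinfE)
  then have "AE \<omega> in M. X \<omega> \<le> C" "AE \<omega> in M. X \<omega> \<ge> - C"
    by (eventually_elim, simp)+
  then have "AE \<omega> in Q. real_cond_exp Q (F t) X \<omega> \<le> C" "AE \<omega> in Q. - C \<le> real_cond_exp Q (F t) X \<omega>"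
    using Linf_integrable[OF assms]
    by (blast intro: Q.real_cond_exp_le_c Q.real_cond_exp_ge_c AE_Q)+
  then have "AE \<omega> in M. real_cond_exp Q (F t) X \<omega> \<le> C" "AE \<omega> in M. - C \<le> real_cond_exp Q (F t) X \<omega>"
    by (simp_all add: AE_le_transfer)
  then have "AE \<omega> in M. \<bar>real_cond_exp Q (F t) X \<omega>\<bar> \<le> C"
    by eventually_elim auto
  then show ?thesis
    by (intro LinfI) auto
qed

lemma cond_exp_mult:
  assumes d: "d \<in> Linf M (F t)" and X: "X \<in> Linf M (F T)"
  shows "AE \<omega> in M. real_cond_exp Q (F t) (\<lambda>\<omega>. d \<omega> * X \<omega>) \<omega> = d \<omega> * real_cond_exp Q (F t) X \<omega>"
proof (rule AE_eq_transfer)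
  show "AE \<omega> in Q. real_cond_exp Q (F t) (\<lambda>\<omega>. d \<omega> * X \<omega>) \<omega> = d \<omega> * real_cond_exp Q (F t) X \<omega>"
    using d X by (intro Q.real_cond_exp_mult)
      (auto intro: Linf_borel_Q Linf_measurable Linf_integrable Linf_mult Linf_F_T[OF time])
qed (use d in \<open>auto dest: Linf_measurable\<close>)

lemma cond_exp_F_meas:
  assumes "X \<in> Linf M (F t)"
  shows "AE \<omega> in M. real_cond_exp Q (F t) X \<omega> = X \<omega>"
  using assms Linf_F_T[OF time assms]
  by (intro AE_eq_transfer Q.real_cond_exp_F_meas) (auto intro: Linf_integrable dest: Linf_measurable)

lemma cond_exp_sum:
  assumes "finite I" "\<And>i. i \<in> I \<Longrightarrow> X i \<in> Linf M (F T)"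
  shows "AE \<omega> in M. real_cond_exp Q (F t) (\<lambda>\<omega>. \<Sum>i\<in>I. X i \<omega>) \<omega> =
    (\<Sum>i\<in>I. real_cond_exp Q (F t) (X i) \<omega>)"
proof -
  \<comment> \<open>The sum rule asks for integrability at every index, so the family is extended by
    zero outside \<open>I\<close>.\<close>
  define Y where "Y i = (if i \<in> I then X i else (\<lambda>_. 0))" for i
  have "integrable Q (Y i)" for i
    using assms(2) by (simp add: Y_def Linf_integrable)
  then have "AE \<omega> in Q. real_cond_exp Q (F t) (\<lambda>\<omega>. \<Sum>i\<in>I. Y i \<omega>) \<omega> =
      (\<Sum>i\<in>I. real_cond_exp Q (F t) (Y i) \<omega>)"
    by (rule Q.real_cond_exp_sum)
  then show ?thesis
    by (intro AE_eq_transfer) (simp_all add: Y_def)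
qed

end

section \<open>Allocation by a fixed pair that attains the supremum at \<open>Y\<close>\<close>

locale dual_maximizer = dual_measure M F T t Q
  for M :: "'a measure" and F :: "real \<Rightarrow> 'a measure" and T t :: real and Q :: "'a measure" +
  fixes c :: "real \<Rightarrow> 'a measure \<Rightarrow> 'a \<Rightarrow> ereal" and \<rho> :: "real \<Rightarrow> ('a \<Rightarrow> real) \<Rightarrow> 'a \<Rightarrow> real"
    and d :: "'a \<Rightarrow> real" and Y :: "'a \<Rightarrow> real"
  assumes d_meas: "d \<in> borel_measurable (F t)" and d_bounds: "AE \<omega> in M. 0 \<le> d \<omega> \<and> d \<omega> \<le> 1"
    and pen_meas: "c t (discounted_measure d Q) \<in> borel_measurable (F t)"
    and pen_nonneg: "AE \<omega> in M. 0 \<le> c t (discounted_measure d Q) \<omega>"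
    and risk_Linf: "\<rho> t Y \<in> Linf M (F t)"
    and attained: "attains M F c \<rho> t d Q Y"
    and Y_Linf: "Y \<in> Linf M (F T)"
begin

text \<open>Real version of the penalty, so that allocations can be computed with in the reals;
  \<open>penalty_finite\<close> shows that it differs from the extended one on a null set
  only.\<close>

abbreviation pen :: "'a \<Rightarrow> real" where
  "pen \<omega> \<equiv> real_of_ereal (c t (discounted_measure d Q) \<omega>)"

abbreviation alloc :: "('a \<Rightarrow> real) \<Rightarrow> 'a \<Rightarrow> real" where
  "alloc X \<omega> \<equiv> real_cond_exp Q (F t) (\<lambda>\<omega>. - (d \<omega> * X \<omega>)) \<omega> - pen \<omega>"

lemma d_Linf: "d \<in> Linf M (F t)"
  using d_bounds by (intro LinfI[where C = 1] d_meas) auto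

lemma discounted_Linf: "X \<in> Linf M (F T) \<Longrightarrow> (\<lambda>\<omega>. - (d \<omega> * X \<omega>)) \<in> Linf M (F T)"
  by (intro Linf_uminus Linf_mult Linf_F_T[OF time d_Linf])

lemma cond_exp_discounted:
  assumes "X \<in> Linf M (F T)"
  shows "AE \<omega> in M. real_cond_exp Q (F t) (\<lambda>\<omega>. - (d \<omega> * X \<omega>)) \<omega> =
    d \<omega> * real_cond_exp Q (F t) (\<lambda>\<omega>. - X \<omega>) \<omega>"
  using cond_exp_mult[OF d_Linf Linf_uminus[OF assms]] by simp

text \<open>Attainment writes the real number \<open>\<rho> t Y \<omega>\<close> as a real number
  minus the penalty, which excludes an infinite penalty.\<close>

lemma penalty_finite:
  "AE \<omega> in M. c t (discounted_measure d Q) \<omega> = ereal (pen \<omega>) \<and> 0 \<le> pen \<omega>"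
  using attained[unfolded attains_def] pen_nonneg
proof eventually_elim
  case (elim \<omega>)
  then show ?case
    by (cases "c t (discounted_measure d Q) \<omega>") (auto simp: penalized_expectation_def)
qed

text \<open>The discount factor stands inside the conditional expectation in \<open>alloc\<close>
  and outside in the dual family; being \<open>F t\<close>-measurable and bounded, it may be moved.
  This holds for every position, not only for the reference \<open>Y\<close>.\<close>

lemma alloc_eq_penalized:
  assumes "X \<in> Linf M (F T)"
  shows "AE \<omega> in M. ereal (alloc X \<omega>) = penalized_expectation F c t d Q X \<omega>"
  using cond_exp_discounted[OF assms] penalty_finite
proof eventually_elim
  case (elim \<omega>)
  then show ?case
    by (cases "c t (discounted_measure d Q) \<omega>") (auto simp: penalized_expectation_def)
qed

lemma alloc_self: "AE \<omega> in M. alloc Y \<omega> = \<rho> t Y \<omega>"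
  using alloc_eq_penalized[OF Y_Linf] attained[unfolded attains_def]
  by eventually_elim (metis ereal.inject)

text \<open>Solving \<open>alloc_self\<close> for the penalty presents it as the difference of a
  bounded conditional expectation and the bounded \<open>\<rho> t Y\<close>.\<close>

lemma pen_Linf: "pen \<in> Linf M (F t)"
proof -
  have "(\<lambda>\<omega>. real_cond_exp Q (F t) (\<lambda>\<omega>. - (d \<omega> * Y \<omega>)) \<omega> + - \<rho> t Y \<omega>) \<in> Linf M (F t)"
    by (intro Linf_add Linf_uminus cond_exp_Linf discounted_Linf Y_Linf risk_Linf)
  then obtain C where
    "AE \<omega> in M. \<bar>real_cond_exp Q (F t) (\<lambda>\<omega>. - (d \<omega> * Y \<omega>)) \<omega> + - \<rho> t Y \<omega>\<bar> \<le> C"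
    by (rule LinfE)
  with alloc_self have "AE \<omega> in M. \<bar>pen \<omega>\<bar> \<le> C"
    by eventually_elim linarith
  with pen_meas show ?thesis
    by (intro LinfI) auto
qed

lemma alloc_Linf:
  assumes "X \<in> Linf M (F T)"
  shows "alloc X \<in> Linf M (F t)"
  using Linf_add[OF cond_exp_Linf[OF discounted_Linf[OF assms]] Linf_uminus[OF pen_Linf]] by simp

lemma alloc_mono:
  assumes "X \<in> Linf M (F T)" "X' \<in> Linf M (F T)" "AE \<omega> in M. X' \<omega> \<le> X \<omega>"
  shows "AE \<omega> in M. alloc X \<omega> \<le> alloc X' \<omega>"
proof -
  have "AE \<omega> in M. - (d \<omega> * X \<omega>) \<le> - (d \<omega> * X' \<omega>)"
    using assms(3) d_bounds by eventually_elim (simp add: mult_left_mono)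
  then have "AE \<omega> in M. real_cond_exp Q (F t) (\<lambda>\<omega>. - (d \<omega> * X \<omega>)) \<omega>
      \<le> real_cond_exp Q (F t) (\<lambda>\<omega>. - (d \<omega> * X' \<omega>)) \<omega>"
    using assms by (intro cond_exp_mono discounted_Linf)
  then show ?thesis
    by eventually_elim simp
qed

text \<open>General weights serve two purposes: convex combinations, and plain sums with all weights
  equal to 1.\<close>

lemma cond_exp_discounted_sum:
  fixes a :: "'b \<Rightarrow> real"
  assumes "finite I" "\<And>i. i \<in> I \<Longrightarrow> X i \<in> Linf M (F T)"
  shows "AE \<omega> in M. real_cond_exp Q (F t) (\<lambda>\<omega>. - (d \<omega> * (\<Sum>i\<in>I. a i * X i \<omega>))) \<omega> =
    (\<Sum>i\<in>I. a i * real_cond_exp Q (F t) (\<lambda>\<omega>. - (d \<omega> * X i \<omega>)) \<omega>)"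
proof -
  have L: "i \<in> I \<Longrightarrow> (\<lambda>\<omega>. - (d \<omega> * X i \<omega>)) \<in> Linf M (F T)" for i
    using assms discounted_Linf by blast
  have eq: "(\<lambda>\<omega>. - (d \<omega> * (\<Sum>i\<in>I. a i * X i \<omega>))) = (\<lambda>\<omega>. \<Sum>i\<in>I. a i * - (d \<omega> * X i \<omega>))"
    by (simp add: sum_distrib_left sum_negf mult.left_commute)
  have "AE \<omega> in M. real_cond_exp Q (F t) (\<lambda>\<omega>. \<Sum>i\<in>I. a i * - (d \<omega> * X i \<omega>)) \<omega> =
      (\<Sum>i\<in>I. real_cond_exp Q (F t) (\<lambda>\<omega>. a i * - (d \<omega> * X i \<omega>)) \<omega>)"
    using L assms(1) by (intro cond_exp_sum Linf_mult Linf_const) auto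
  \<comment> \<open>Each weight is pulled out as a constant \<open>F t\<close>-measurable factor;
    finitely many null sets are merged into one.\<close>
  moreover have "AE \<omega> in M. \<forall>i\<in>I. real_cond_exp Q (F t) (\<lambda>\<omega>. a i * - (d \<omega> * X i \<omega>)) \<omega> =
      a i * real_cond_exp Q (F t) (\<lambda>\<omega>. - (d \<omega> * X i \<omega>)) \<omega>"
    using L assms(1) by (intro AE_finite_allI cond_exp_mult Linf_const) auto
  ultimately show ?thesis
    unfolding eq by eventually_elim (simp cong: sum.cong)
qed

text \<open>The weights sum to one, so the averaged allocations contain the penalty exactly once and
  equality holds.\<close>

lemma alloc_convex_combination:
  assumes "finite I" "\<And>i. i \<in> I \<Longrightarrow> X i \<in> Linf M (F T)" "sum a I = 1"
  shows "AE \<omega> in M. alloc (\<lambda>\<omega>. \<Sum>i\<in>I. a i * X i \<omega>) \<omega> = (\<Sum>i\<in>I. a i * alloc (X i) \<omega>)"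
proof -
  have "AE \<omega> in M. real_cond_exp Q (F t) (\<lambda>\<omega>. - (d \<omega> * (\<Sum>i\<in>I. a i * X i \<omega>))) \<omega> =
      (\<Sum>i\<in>I. a i * real_cond_exp Q (F t) (\<lambda>\<omega>. - (d \<omega> * X i \<omega>)) \<omega>)"
    using assms(1,2) by (rule cond_exp_discounted_sum)
  then show ?thesis
    by eventually_elim
      (simp add: right_diff_distrib sum_subtractf sum_distrib_right[symmetric] assms(3))
qed

text \<open>The left side subtracts the penalty once per index, the right side only once. As
  \<open>I\<close> is nonempty and the penalty nonnegative, the left side is the smaller
  one.\<close>

lemma alloc_sum_ge:
  assumes "finite I" "I \<noteq> {}" "\<And>i. i \<in> I \<Longrightarrow> X i \<in> Linf M (F T)"
  shows "AE \<omega> in M. (\<Sum>i\<in>I. alloc (X i) \<omega>) \<le> alloc (\<lambda>\<omega>. \<Sum>i\<in>I. X i \<omega>) \<omega>"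
  using cond_exp_discounted_sum[where a = "\<lambda>_. 1" and X = X, OF assms(1,3), simplified] penalty_finite
proof eventually_elim
  case (elim \<omega>)
  have "1 * pen \<omega> \<le> real (card I) * pen \<omega>"
    using elim assms by (intro mult_right_mono) (auto simp: Suc_le_eq card_gt_0_iff)
  with elim show ?case
    by (simp add: sum_subtractf)
qed

text \<open>Adding \<open>m\<close> lowers the allocation by \<open>d * m\<close>, since this
  product is known at time \<open>t\<close>; and \<open>d * m\<close> is at most
  \<open>m\<close>.\<close>

lemma alloc_cash_subadditive:
  assumes "X \<in> Linf M (F T)" "m \<in> Linf_plus M (F t)"
  shows "AE \<omega> in M. alloc X \<omega> - m \<omega> \<le> alloc (\<lambda>\<omega>. X \<omega> + m \<omega>) \<omega>"
proof -
  have m: "m \<in> Linf M (F t)" "AE \<omega> in M. 0 \<le> m \<omega>"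
    using assms by (auto simp: Linf_plus_def)
  have dm: "(\<lambda>\<omega>. - (d \<omega> * m \<omega>)) \<in> Linf M (F t)"
    by (intro Linf_uminus Linf_mult d_Linf m)
  have "AE \<omega> in M. real_cond_exp Q (F t) (\<lambda>\<omega>. - (d \<omega> * X \<omega>) + - (d \<omega> * m \<omega>)) \<omega> =
      real_cond_exp Q (F t) (\<lambda>\<omega>. - (d \<omega> * X \<omega>)) \<omega> + real_cond_exp Q (F t) (\<lambda>\<omega>. - (d \<omega> * m \<omega>)) \<omega>"
    by (intro AE_eq_transfer Q.real_cond_exp_add Linf_integrable discounted_Linf assms(1)
        Linf_F_T[OF time dm] borel_measurable_add borel_measurable_cond_exp)
  then have "AE \<omega> in M. real_cond_exp Q (F t) (\<lambda>\<omega>. - (d \<omega> * (X \<omega> + m \<omega>))) \<omega> =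
      real_cond_exp Q (F t) (\<lambda>\<omega>. - (d \<omega> * X \<omega>)) \<omega> + real_cond_exp Q (F t) (\<lambda>\<omega>. - (d \<omega> * m \<omega>)) \<omega>"
    by (simp add: distrib_left)
  with cond_exp_F_meas[OF dm] d_bounds m(2) show ?thesis
  proof eventually_elim
    case (elim \<omega>)
    then have "d \<omega> * m \<omega> \<le> 1 * m \<omega>"
      by (intro mult_right_mono) auto
    with elim show ?case
      by simp
  qed
qed

text \<open>The maximizer for \<open>Y\<close> is admissible in the supremum for \<open>X\<close>.
  The process \<open>D\<close> is there to exhibit the random variable \<open>d\<close> as the value
  at \<open>t\<close> of a member of \<open>discount_processes\<close>.\<close>

lemma alloc_le_risk:
  assumes "dual_representation M F T c \<rho>" "X \<in> Linf M (F T)"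
    "D \<in> discount_processes M F T" "D t = d"
  shows "AE \<omega> in M. alloc X \<omega> \<le> \<rho> t X \<omega>"
proof -
  have "AE \<omega> in M. penalized_expectation F c t d Q X \<omega> \<le> ereal (\<rho> t X \<omega>)"
    using assms time dual unfolding dual_representation_def is_ess_sup_def by blast
  with alloc_eq_penalized[OF assms(2)] show ?thesis
    by eventually_elim (metis ereal_less_eq(3))
qed

end

section \<open>The axioms for the subdifferential CAR, and existence of a selection (part
  (b))\<close>

context filtered_prob_space
begin

lemma subdifferential_CAR_properties:
  assumes crm: "convex_risk_measure M F T \<rho>" and gp: "generalized_penalty M F T c"
    and rep: "dual_representation M F T c \<rho>" and sel: "optimal_selection M F T c \<rho> D Q"
  defines "\<Lambda> \<equiv> subdifferential_CAR F c D Q"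
  shows "CAR_associated M F T \<rho> \<Lambda>" "car_no_undercut M F T \<Lambda>" "car_monotone M F T \<Lambda>"
    "car_weak_convex M F T \<Lambda>" "car_1_cash_subadditive M F T \<Lambda>" "car_sub_allocation M F T \<Lambda>"
proof -
  \<comment> \<open>Every time and reference position yields its own instance of the locale, which
    settles the axioms that keep the second argument fixed.\<close>
  have max: "dual_maximizer M F T t (Q Y t) c \<rho> (D Y t) Y"
    if t: "t \<in> {0..T}" and Y: "Y \<in> Linf M (F T)" for t Y
  proof -
    have D: "D Y \<in> discount_processes M F T" and Q: "Q Y t \<in> dual_measures M F t"
      and "attains M F c \<rho> t (D Y t) (Q Y t) Y"
      using sel t Y unfolding optimal_selection_def by blast+
    moreover have "\<rho> t Y \<in> Linf M (F t)"
      using crm t Y by (auto simp: convex_risk_measure_def dynamic_risk_measure_def)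
    ultimately show ?thesis
      using gp t Y by unfold_locales (auto simp: generalized_penalty_def discount_processes_def)
  qed
  have \<Lambda>: "\<Lambda> t X Y = (\<lambda>\<omega>. real_cond_exp (Q Y t) (F t) (\<lambda>\<omega>. - (D Y t \<omega> * X \<omega>)) \<omega>
     - real_of_ereal (c t (discounted_measure (D Y t) (Q Y t)) \<omega>))" for t X Y
    by (simp add: \<Lambda>_def subdifferential_CAR_def fun_eq_iff)
  have cong: "AE \<omega> in M. \<Lambda> t X Y \<omega> = \<Lambda> t X' Y' \<omega>"
    if t: "t \<in> {0..T}" and L: "X \<in> Linf M (F T)" "X' \<in> Linf M (F T)" "Y \<in> Linf M (F T)" "Y' \<in> Linf M (F T)"
      and eq: "AE \<omega> in M. X \<omega> = X' \<omega>" "AE \<omega> in M. Y \<omega> = Y' \<omega>" for t X X' Y Y'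
  proof -
    interpret A: dual_maximizer M F T t "Q Y t" c \<rho> "D Y t" Y
      by (rule max[OF t L(3)])
    interpret B: dual_maximizer M F T t "Q Y' t" c \<rho> "D Y' t" Y'
      by (rule max[OF t L(4)])
    have Q: "Q Y' t = Q Y t" and D: "AE \<omega> in M. D Y t \<omega> = D Y' t \<omega>"
      using sel[unfolded optimal_selection_def, THEN conjunct2, rule_format, OF L(3,4) eq(2) t] by auto
    have meas: "D Y t \<in> borel_measurable (Q Y t)" "D Y' t \<in> borel_measurable (Q Y t)"
      by (intro A.Linf_borel_Q Linf_F_T[OF t] A.d_Linf B.d_Linf)+
    \<comment> \<open>Densities equal \<open>Q\<close>-almost everywhere define the same measure, so
      the two penalties agree as functions; no regularity of \<open>c\<close> in its measure
      argument enters.\<close>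
    have "discounted_measure (D Y t) (Q Y t) = discounted_measure (D Y' t) (Q Y' t)"
      unfolding discounted_measure_def Q
      using meas A.AE_Q[OF D] by (intro density_cong) auto
    moreover have "AE \<omega> in M. real_cond_exp (Q Y t) (F t) (\<lambda>\<omega>. - (D Y t \<omega> * X \<omega>)) \<omega> =
        real_cond_exp (Q Y t) (F t) (\<lambda>\<omega>. - (D Y' t \<omega> * X' \<omega>)) \<omega>"
      using D eq(1) L by (intro A.cond_exp_cong A.discounted_Linf B.discounted_Linf) auto
    ultimately show ?thesis
      by (simp add: \<Lambda> Q)
  qed
  have Linf: "\<Lambda> t X Y \<in> Linf M (F t)"
    if "t \<in> {0..T}" "X \<in> Linf M (F T)" "Y \<in> Linf M (F T)" for t X Y
    using dual_maximizer.alloc_Linf[OF max] that by (simp add: \<Lambda>)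
  have self: "AE \<omega> in M. \<Lambda> t X X \<omega> = \<rho> t X \<omega>" if "t \<in> {0..T}" "X \<in> Linf M (F T)" for t X
    using dual_maximizer.alloc_self[OF max] that by (simp add: \<Lambda>)
  show "CAR_associated M F T \<rho> \<Lambda>"
    unfolding CAR_associated_def using cong Linf self by blast
  show "car_no_undercut M F T \<Lambda>"
    unfolding car_no_undercut_def
  proof (intro ballI)
    fix t X Y
    assume *: "t \<in> {0..T}" "X \<in> Linf M (F T)" "Y \<in> Linf M (F T)"
    have "D Y \<in> discount_processes M F T"
      using sel * unfolding optimal_selection_def by blast
    then have "AE \<omega> in M. \<Lambda> t X Y \<omega> \<le> \<rho> t X \<omega>"
      using dual_maximizer.alloc_le_risk[OF max rep] * by (simp add: \<Lambda>)
    with self[OF *(1,2)] show "AE \<omega> in M. \<Lambda> t X Y \<omega> \<le> \<Lambda> t X X \<omega>"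
      by eventually_elim simp
  qed
  show "car_monotone M F T \<Lambda>"
    unfolding car_monotone_def
    using dual_maximizer.alloc_mono[OF max] by (simp add: \<Lambda>)
  show "car_1_cash_subadditive M F T \<Lambda>"
    unfolding car_1_cash_subadditive_def
    using dual_maximizer.alloc_cash_subadditive[OF max] by (simp add: \<Lambda>)
  show "car_weak_convex M F T \<Lambda>"
    unfolding car_weak_convex_def
  proof (intro ballI allI impI)
    fix t X k and Xs :: "nat \<Rightarrow> 'a \<Rightarrow> real" and a :: "nat \<Rightarrow> real"
    assume *: "t \<in> {0..T}" "X \<in> Linf M (F T)" "\<forall>i\<in>{1..k}. Xs i \<in> Linf M (F T)" "(\<Sum>i=1..k. a i) = 1"
    have "AE \<omega> in M. \<Lambda> t (\<lambda>\<omega>. \<Sum>i=1..k. a i * Xs i \<omega>) X \<omega> = (\<Sum>i=1..k. a i * \<Lambda> t (Xs i) X \<omega>)"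
      unfolding \<Lambda> using * by (intro dual_maximizer.alloc_convex_combination[OF max]) auto
    then show "AE \<omega> in M. \<Lambda> t (\<lambda>\<omega>. \<Sum>i=1..k. a i * Xs i \<omega>) X \<omega> \<le> (\<Sum>i=1..k. a i * \<Lambda> t (Xs i) X \<omega>)"
      by eventually_elim simp
  qed
  show "car_sub_allocation M F T \<Lambda>"
    unfolding car_sub_allocation_def
  proof (intro ballI allI impI)
    fix t X and k :: nat and Xs :: "nat \<Rightarrow> 'a \<Rightarrow> real"
    assume *: "t \<in> {0..T}" "X \<in> Linf M (F T)" "k \<ge> 1" "\<forall>i\<in>{1..k}. Xs i \<in> Linf M (F T)"
      "AE \<omega> in M. (\<Sum>i=1..k. Xs i \<omega>) = X \<omega>"
    have "AE \<omega> in M. (\<Sum>i=1..k. \<Lambda> t (Xs i) X \<omega>) \<le> \<Lambda> t (\<lambda>\<omega>. \<Sum>i=1..k. Xs i \<omega>) X \<omega>"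
      unfolding \<Lambda> using * by (intro dual_maximizer.alloc_sum_ge[OF max]) auto
    \<comment> \<open>The parts add up to \<open>X\<close> only almost surely, so the first argument
      is replaced by means of well-definedness on classes.\<close>
    moreover have "AE \<omega> in M. \<Lambda> t (\<lambda>\<omega>. \<Sum>i=1..k. Xs i \<omega>) X \<omega> = \<Lambda> t X X \<omega>"
      using * by (intro cong Linf_sum) auto
    ultimately show "AE \<omega> in M. \<Lambda> t X X \<omega> \<ge> (\<Sum>i=1..k. \<Lambda> t (Xs i) X \<omega>)"
      by eventually_elim simp
  qed
qed

text \<open>Lets a maximizer found for the representative of a class serve every member of that
  class.\<close>

lemma attains_cong:
  assumes crm: "dynamic_risk_measure M F T \<rho>" and t: "t \<in> {0..T}" and Q: "Q \<in> dual_measures M F t"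
    and X: "X \<in> Linf M (F T)" and Y: "Y \<in> Linf M (F T)" and eq: "AE \<omega> in M. X \<omega> = Y \<omega>"
    and att: "attains M F c \<rho> t d Q X"
  shows "attains M F c \<rho> t d Q Y"
proof -
  interpret dual_measure M F T t Q
    using t Q by unfold_locales
  have "AE \<omega> in M. \<rho> t X \<omega> = \<rho> t Y \<omega>"
    using crm t X Y eq unfolding dynamic_risk_measure_def by blast
  moreover have "AE \<omega> in M. real_cond_exp Q (F t) (\<lambda>\<omega>. - X \<omega>) \<omega> = real_cond_exp Q (F t) (\<lambda>\<omega>. - Y \<omega>) \<omega>"
    using eq by (intro cond_exp_cong Linf_uminus X Y) auto
  ultimately show ?thesis
    using att unfolding attains_def
    by eventually_elim (simp add: penalized_expectation_def)
qed

text \<open>Attainment gives a pair separately for each time and position. A selection must depend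
  on the class of the position alone and carry one discount process for all times, so
  representatives are chosen and the processes are pasted together over time.\<close>

lemma optimal_selection_exists:
  assumes crm: "dynamic_risk_measure M F T \<rho>" and att: "dual_attainment M F T c \<rho>"
  obtains D Q where "optimal_selection M F T c \<rho> D Q"
proof -
  have "\<exists>p. fst p \<in> discount_processes M F T \<and> snd p \<in> dual_measures M F t \<and>
      attains M F c \<rho> t (fst p t) (snd p) X"
    if "t \<in> {0..T}" "X \<in> Linf M (F T)" for t X
    using att that unfolding dual_attainment_def by force
  then obtain p where p: "\<And>t X. t \<in> {0..T} \<Longrightarrow> X \<in> Linf M (F T) \<Longrightarrow>
      fst (p t X) \<in> discount_processes M F T \<and> snd (p t X) \<in> dual_measures M F t \<and>
      attains M F c \<rho> t (fst (p t X) t) (snd (p t X)) X"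
    by metis
  \<comment> \<open>One representative of each class of almost surely equal positions, so that the selection
    only depends on the class.\<close>
  define r where "r Y = (SOME X. X \<in> Linf M (F T) \<and> (AE \<omega> in M. X \<omega> = Y \<omega>))" for Y
  have r: "r Y \<in> Linf M (F T) \<and> (AE \<omega> in M. r Y \<omega> = Y \<omega>)" if "Y \<in> Linf M (F T)" for Y
    unfolding r_def by (rule someI[of _ Y]) (use that in auto)
  have r_eq: "r Y = r Y'" if "AE \<omega> in M. Y \<omega> = Y' \<omega>" for Y Y'
  proof -
    \<comment> \<open>Almost surely equal positions make the predicates under \<open>SOME\<close>
      coincide, and then the chosen representatives are identical.\<close>
    have "(AE \<omega> in M. X \<omega> = Y \<omega>) \<longleftrightarrow> (AE \<omega> in M. X \<omega> = Y' \<omega>)" for X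
      using that by (auto elim: eventually_elim2)
    then show ?thesis
      by (simp add: r_def)
  qed
  \<comment> \<open>At time \<open>t\<close> the pasted process takes the value at \<open>t\<close>
    of the process chosen for \<open>t\<close>. It is admissible because measurability and bounds
    are required at each time separately.\<close>
  define D where "D Y t = fst (p t (r Y)) t" for Y t
  define Q where "Q Y t = snd (p t (r Y))" for Y t
  have "optimal_selection M F T c \<rho> D Q"
    unfolding optimal_selection_def
  proof (intro conjI ballI impI)
    fix Y assume Y: "Y \<in> Linf M (F T)"
    show "D Y \<in> discount_processes M F T"
      using p r[OF Y] unfolding D_def discount_processes_def by blast
    fix t assume t: "t \<in> {0..T}"
    show "Q Y t \<in> dual_measures M F t"
      using p[OF t] r[OF Y] by (simp add: Q_def)
    show "attains M F c \<rho> t (D Y t) (Q Y t) Y"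
      unfolding D_def Q_def
      by (rule attains_cong[OF crm t _ conjunct1[OF r[OF Y]] Y conjunct2[OF r[OF Y]]])
        (use p[OF t conjunct1[OF r[OF Y]]] in simp_all)
  next
    fix Y Y' :: "'a \<Rightarrow> real" and t
    assume "AE \<omega> in M. Y \<omega> = Y' \<omega>"
    then have "r Y = r Y'"
      by (rule r_eq)
    then show "AE \<omega> in M. D Y t \<omega> = D Y' t \<omega>" "Q Y t = Q Y' t"
      by (simp_all add: D_def Q_def)
  qed
  then show ?thesis
    by (rule that)
qed

end

section \<open>Both directions of the correspondence between CARs and risk measures\<close>

theorem proposition10:
  fixes M :: "'a measure" and F :: "real \<Rightarrow> 'a measure" and T :: real
  assumes "filtered_prob_space M F T"
  shows
    "(\<forall>\<Lambda>. dynamic_CAR M F T \<Lambda> \<and> car_no_undercut M F T \<Lambda> \<and> car_monotone M F T \<Lambda> \<and>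
          car_weak_convex M F T \<Lambda> \<and> car_normalized M F T \<Lambda> \<and> car_cash_subadditive M F T \<Lambda> \<longrightarrow>
        (let \<rho> = (\<lambda>t X. \<Lambda> t X X) in
          (car_1_time_consistent M F T \<Lambda> \<longrightarrow>
             convex_risk_measure M F T \<rho> \<and> rm_cash_subadditive M F T \<rho> \<and>
             rm_weakly_time_consistent M F T \<rho>) \<and>
          (car_time_consistent M F T \<Lambda> \<longrightarrow>
             convex_risk_measure M F T \<rho> \<and> rm_cash_subadditive M F T \<rho> \<and>
             rm_time_consistent M F T \<rho>)))
     \<and>
     (\<forall>\<rho> c. convex_risk_measure M F T \<rho> \<and> rm_cash_subadditive M F T \<rho> \<and>
          generalized_penalty M F T c \<and> dual_representation M F T c \<rho> \<and>
          dual_attainment M F T c \<rho> \<longrightarrow>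
        (\<exists>\<Lambda>. CAR_associated M F T \<rho> \<Lambda> \<and> car_no_undercut M F T \<Lambda> \<and> car_monotone M F T \<Lambda> \<and>
          car_weak_convex M F T \<Lambda> \<and> car_1_cash_subadditive M F T \<Lambda> \<and>
          car_sub_allocation M F T \<Lambda>) \<and>
        (\<forall>D Q. optimal_selection M F T c \<rho> D Q \<longrightarrow>
          (let \<Lambda> = subdifferential_CAR F c D Q in
            CAR_associated M F T \<rho> \<Lambda> \<and> car_no_undercut M F T \<Lambda> \<and> car_monotone M F T \<Lambda> \<and>
            car_weak_convex M F T \<Lambda> \<and> car_1_cash_subadditive M F T \<Lambda> \<and>
            car_sub_allocation M F T \<Lambda>)))"
proof -
  interpret filtered_prob_space M F T
    by (rule assms)
  show ?thesis
  proof (rule conjI, goal_cases)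
    case 1
    show ?case
      by (simp add: Let_def convex_risk_measure_diagonal cash_subadditive_diagonal
        weakly_time_consistent_diagonal time_consistent_diagonal)
  next
    case 2
    show ?case
    proof (intro allI impI, goal_cases)
      case (1 \<rho> c)
      then have *: "convex_risk_measure M F T \<rho>" "generalized_penalty M F T c"
          "dual_representation M F T c \<rho>" "dual_attainment M F T c \<rho>"
        by auto
      \<comment> \<open>Kept general in the selection: it is applied to one obtained by choice, for
        existence, and to an arbitrary one, for the claim on the subdifferential CAR.\<close>
      note sub = subdifferential_CAR_properties[OF *(1-3)]
      obtain D Q where "optimal_selection M F T c \<rho> D Q"
        using *(1,4) by (auto simp: convex_risk_measure_def elim!: optimal_selection_exists)
      note sub_DQ = sub[OF this]
      show ?case
      proof (rule conjI, goal_cases)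
        case 1
        show ?case
          by (intro exI[of _ "subdifferential_CAR F c D Q"] conjI sub_DQ)
      next
        case 2
        show ?case
          by (simp add: Let_def sub)
      qed
    qed
  qed
qed

end
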